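(* Let $\lambda\in\mathbb C$ and let $\mathfrak{gl}(\lambda)$ be as in the context. Let $V$ be a quasi-finite highest weight $\mathfrak{gl}(\lambda)$-module with highest weight $\theta\in\mathfrak{gl}(\lambda)_0^*$, and let $F_\theta(t)=\sum_{k\ge 0}\frac{\theta(H^k)}{k!}t^k$. Then $F_\theta(t)=\dfrac{R(t)}{1-e^{-2t}}$, where $R(t)$ is a quasi-polynomial with $R(0)=0$.
   Context: For $\lambda\in\mathbb C$ let $\mathfrak A_\lambda$ be the associative unital algebra generated by $X,Y,H$ subject to $XY-YX=H$, $HY-YH=-2Y$, $HX-XH=2X$, $XY=\frac14(\lambda^2-(H-1)^2)$, and additionally $X^{|\lambda|}=0$ if $\lambda\in\mathbb Z\setminus\{0\}$ (for $\lambda\notin\mathbb Z\setminus\{0\}$ this is $U(\mathfrak{sl}(2))$ modulo the two-sided ideal generated by $2YX+\frac12H^2+H-\frac12(\lambda^2-1)$; for $\lambda\in\mathbb Z\setminus\{0\}$ it is the matrix algebra $\mathrm{Mat}(|\lambda|)$). $\mathfrak{gl}(\lambda)$ is $\mathfrak A_\lambda$ regarded as a Lie algebra with bracket $[a,b]=ab-ba$. It is $\mathbb Z$-graded: $\mathfrak{gl}(\lambda)_i=\{z:[H,z]=2iz\}$; $\mathfrak{gl}(\lambda)_0$ is the commutative subalgebra generated by $H$ (the image of $\mathbb C[H]$). Set $\mathfrak g_+=\bigoplus_{i>0}\mathfrak{gl}(\lambda)_i$. A $\mathfrak{gl}(\lambda)$-module $V$ is a highest weight module with highest weight $\theta\in\mathfrak{gl}(\lambda)_0^*$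 if it is generated by a vector $v$ with $\mathfrak g_+v=0$ and $hv=\theta(h)v$ for all $h\in\mathfrak{gl}(\lambda)_0$. A module is quasi-finite if it is graded, $V=\bigoplus_{j\in\mathbb Z}V_j$ with $\mathfrak{gl}(\lambda)_iV_j\subset V_{i+j}$, and $\dim V_j<\infty$ for all $j$. A quasi-polynomial is a finite sum $\sum_i R_i(t)e^{a_it}$ with polynomials $R_i$ and $a_i\in\mathbb C$. *)

theory Defs
  imports Complex_Main "HOL-Computational_Algebra.Polynomial"
begin

datatype gen = GX | GY | GH

type_synonym ncpoly = "gen list \<Rightarrow> complex"

definition FreeAlg :: "ncpoly set" where
  "FreeAlg = {a. finite {w. a w \<noteq> 0}}"

definition fzero :: ncpoly where "fzero = (\<lambda>w. 0)"
definition fadd :: "ncpoly \<Rightarrow> ncpoly \<Rightarrow> ncpoly" where "fadd a b = (\<lambda>w. a w + b w)"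
definition fsc :: "complex \<Rightarrow> ncpoly \<Rightarrow> ncpoly" where "fsc c a = (\<lambda>w. c * a w)"
definition fsub :: "ncpoly \<Rightarrow> ncpoly \<Rightarrow> ncpoly" where "fsub a b = (\<lambda>w. a w - b w)"
definition fmul :: "ncpoly \<Rightarrow> ncpoly \<Rightarrow> ncpoly" where
  "fmul a b = (\<lambda>w. \<Sum>i\<le>length w. a (take i w) * b (drop i w))"
definition fmon :: "gen list \<Rightarrow> ncpoly" where "fmon u = (\<lambda>w. if w = u then 1 else 0)"
definition fbr :: "ncpoly \<Rightarrow> ncpoly \<Rightarrow> ncpoly" where "fbr a b = fsub (fmul a b) (fmul b a)"

abbreviation "fX \<equiv> fmon [GX]"
abbreviation "fY \<equiv> fmon [GY]"
abbreviation "fH \<equiv> fmon [GH]"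
abbreviation "fone \<equiv> fmon []"

inductive_set ideal_gen :: "ncpoly set \<Rightarrow> ncpoly set" for R where
  gen: "r \<in> R \<Longrightarrow> r \<in> ideal_gen R"
| zero: "fzero \<in> ideal_gen R"
| add: "a \<in> ideal_gen R \<Longrightarrow> b \<in> ideal_gen R \<Longrightarrow> fadd a b \<in> ideal_gen R"
| smult: "a \<in> ideal_gen R \<Longrightarrow> fsc c a \<in> ideal_gen R"
| lmult: "a \<in> ideal_gen R \<Longrightarrow> p \<in> FreeAlg \<Longrightarrow> fmul p a \<in> ideal_gen R"
| rmult: "a \<in> ideal_gen R \<Longrightarrow> p \<in> FreeAlg \<Longrightarrow> fmul a p \<in> ideal_gen R"

definition rels :: "complex \<Rightarrow> ncpoly set" where
  "rels lam =
     { fsub (fbr fX fY) fH,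
       fadd (fbr fH fY) (fsc 2 fY),
       fsub (fbr fH fX) (fsc 2 fX),
       \<comment> \<open>XY - (1/4)(lam^2 - (H-1)^2) = XY - (1/4) lam^2 + (1/4) H^2 - (1/2) H + 1/4\<close>
       fadd (fsub (fmul fX fY) (fsc (lam\<^sup>2 / 4) fone))
            (fadd (fsc (1/4) (fmul fH fH)) (fsub (fsc (1/4) fone) (fsc (1/2) fH))) }
   \<union> { fmon (replicate n GX) | n. lam \<in> \<int> \<and> lam \<noteq> 0 \<and> n > 0 \<and>
                                  (of_nat n = lam \<or> of_nat n = - lam) }"

text \<open>The ideal; \<open>\<AA>_\<lambda> = FreeAlg / rel_ideal lam\<close>.\<close>
definition rel_ideal :: "complex \<Rightarrow> ncpoly set" where
  "rel_ideal lam = ideal_gen (rels lam)"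

text \<open>A representative \<open>z\<close> lies in \<open>gl(\<lambda>)_i\<close> iff \<open>[H,z] = 2 i z\<close> holds in the quotient.\<close>
definition gl_grade :: "complex \<Rightarrow> int \<Rightarrow> ncpoly set" where
  "gl_grade lam i = {z \<in> FreeAlg. fsub (fbr fH z) (fsc (2 * of_int i) z) \<in> rel_ideal lam}"

text \<open>A representation of the Lie algebra \<open>gl(\<lambda>) = FreeAlg / rel_ideal lam\<close> on the complex
  vector space \<open>('v, sc)\<close>, given through the lift \<open>\<rho>\<close> to the free algebra: \<open>\<rho>\<close> is linear,
  each \<open>\<rho> a\<close> is a linear endomorphism, \<open>\<rho>\<close> kills the ideal, and \<open>\<rho>\<close> preserves commutators.\<close>
definition gl_rep :: "complex \<Rightarrow> (complex \<Rightarrow> 'v::ab_group_add \<Rightarrow> 'v) \<Rightarrow> (ncpoly \<Rightarrow> 'v \<Rightarrow> 'v) \<Rightarrow> bool" where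
  "gl_rep lam sc \<rho> \<longleftrightarrow>
     vector_space sc \<and>
     (\<forall>a\<in>FreeAlg. Vector_Spaces.linear sc sc (\<rho> a)) \<and>
     (\<forall>a\<in>FreeAlg. \<forall>b\<in>FreeAlg. \<forall>x. \<rho> (fadd a b) x = \<rho> a x + \<rho> b x) \<and>
     (\<forall>a\<in>FreeAlg. \<forall>c x. \<rho> (fsc c a) x = sc c (\<rho> a x)) \<and>
     (\<forall>a\<in>rel_ideal lam. \<forall>x. \<rho> a x = 0) \<and>
     (\<forall>a\<in>FreeAlg. \<forall>b\<in>FreeAlg. \<forall>x. \<rho> (fbr a b) x = \<rho> a (\<rho> b x) - \<rho> b (\<rho> a x))"

definition quasi_finite ::
  "complex \<Rightarrow> (complex \<Rightarrow> 'v::ab_group_add \<Rightarrow> 'v) \<Rightarrow> (ncpoly \<Rightarrow> 'v \<Rightarrow> 'v) \<Rightarrow> (int \<Rightarrow> 'v set) \<Rightarrow> bool" where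
  "quasi_finite lam sc \<rho> Vg \<longleftrightarrow>
     (\<forall>j. module.subspace sc (Vg j)) \<and>
     (\<forall>x. \<exists>!f. finite {j. f j \<noteq> 0} \<and> (\<forall>j. f j \<in> Vg j) \<and> x = (\<Sum>j\<in>{j. f j \<noteq> 0}. f j)) \<and>
     (\<forall>i j. \<forall>a\<in>gl_grade lam i. \<rho> a ` Vg j \<subseteq> Vg (i + j)) \<and>
     (\<forall>j. \<exists>B. finite B \<and> B \<subseteq> Vg j \<and> Vg j \<subseteq> module.span sc B)"

text \<open>Highest weight module with highest weight vector \<open>v \<noteq> 0\<close> and highest weight \<open>\<theta>\<close>
  (a functional on \<open>gl(\<lambda>)_0\<close>, given on representatives).\<close>
definition highest_weight ::
  "complex \<Rightarrow> (complex \<Rightarrow> 'v::ab_group_add \<Rightarrow> 'v) \<Rightarrow> (ncpoly \<Rightarrow> 'v \<Rightarrow> 'v) \<Rightarrow> 'v \<Rightarrow> (ncpoly \<Rightarrow> complex) \<Rightarrow> bool" where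
  "highest_weight lam sc \<rho> v \<theta> \<longleftrightarrow>
     v \<noteq> 0 \<and>
     (\<forall>W. module.subspace sc W \<and> v \<in> W \<and> (\<forall>a\<in>FreeAlg. \<rho> a ` W \<subseteq> W) \<longrightarrow> W = UNIV) \<and>
     (\<forall>i>0. \<forall>a\<in>gl_grade lam i. \<rho> a v = 0) \<and>
     (\<forall>h\<in>gl_grade lam 0. \<rho> h v = sc (\<theta> h) v)"

definition quasi_polynomial :: "(complex \<Rightarrow> complex) \<Rightarrow> bool" where
  "quasi_polynomial R \<longleftrightarrow>
     (\<exists>ps :: (complex poly \<times> complex) list. \<forall>t. R t = (\<Sum>(p, a)\<leftarrow>ps. poly p t * exp (a * t)))"

end

theory Submission
  imports Defs "HOL-Analysis.FPS_Convergence"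
    "HOL-Computational_Algebra.Fundamental_Theorem_Algebra"
begin

text \<open>
  Let \<open>u\<close> be a homogeneous highest weight vector. The vectors \<open>Y H\<^sup>k u\<close> all lie in one
  finite-dimensional graded piece, so \<open>Y f(H) u = 0\<close> for some polynomial \<open>f \<noteq> 0\<close>. Applying
  \<open>X g(H)\<close> and using \<open>XY = P(H)\<close>, where \<open>P(H) = (\<lambda>\<^sup>2 - (H - 1)\<^sup>2)/4\<close>, gives
  \<open>\<theta>((q g)(H) - (q g)(H - 2)) = 0\<close> for every polynomial \<open>g\<close>, where \<open>q(H) = (P f)(H + 2)\<close>.
  Hence the sequence \<open>\<theta>(H\<^sup>k - (H - 2)\<^sup>k)\<close> satisfies a linear recurrence with characteristic
  polynomial \<open>q\<close>, so its exponential generating function \<open>F\<^sub>\<theta>(t) (1 - e\<^bsup>-2t\<^esup>)\<close> is a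
  quasi-polynomial.
\<close>

subsection \<open>Quasi-polynomials as formal power series\<close>

text \<open>Finite sums of terms p(t) e^(at), kept as formal series and built one term at a time:
  closure properties follow by induction on the terms, and convergence is postponed until the final
  passage to functions.\<close>

inductive quasi_poly_fps :: "complex fps \<Rightarrow> bool" where
  zero: "quasi_poly_fps 0"
| add: "quasi_poly_fps F \<Longrightarrow> quasi_poly_fps (fps_of_poly p * fps_exp a + F)"

lemma quasi_poly_fps_term: "quasi_poly_fps (fps_of_poly p * fps_exp a)"
  using quasi_poly_fps.add[OF quasi_poly_fps.zero] by simp

lemma quasi_poly_fps_add:
  assumes "quasi_poly_fps F" "quasi_poly_fps G"
  shows "quasi_poly_fps (F + G)"
  using assms by induction (auto simp: add.assoc intro: quasi_poly_fps.add)

lemma quasi_poly_fps_const: "quasi_poly_fps (fps_const c)"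
  using quasi_poly_fps_term[of "[:c:]" 0] by (simp add: fps_of_poly_const)

lemma quasi_poly_fps_mult_exp:
  assumes "quasi_poly_fps F"
  shows "quasi_poly_fps (fps_exp b * F)"
  using assms
proof induction
  case zero
  show ?case by (simp add: quasi_poly_fps.zero)
next
  case (add F p a)
  have "fps_exp b * (fps_of_poly p * fps_exp a + F) = fps_of_poly p * fps_exp (b + a) + fps_exp b * F"
    by (simp add: fps_exp_add_mult algebra_simps)
  then show ?case using add.IH by (simp add: quasi_poly_fps.add)
qed

section \<open>Integration of quasi-polynomials\<close>

lemma poly_antiderivative: "\<exists>r::complex poly. pderiv r = p"
proof
  show "pderiv (\<Sum>i\<le>degree p. monom (coeff p i / of_nat (Suc i)) (Suc i)) = p"
    by (rule poly_eqI) (auto simp: coeff_pderiv coeff_sum coeff_eq_0 simp del: of_nat_Suc)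
qed

text \<open>Such an r makes r(t) e^(bt) an antiderivative of p(t) e^(bt). The first guess p/b
  overshoots by p'/b, which has smaller degree and is corrected by induction.\<close>

lemma poly_exp_antiderivative:
  fixes b :: complex
  assumes "b \<noteq> 0"
  shows "\<exists>r. pderiv r + smult b r = p"
proof (induction "degree p" arbitrary: p rule: less_induct)
  case less
  show ?case
  proof (cases "degree p = 0")
    case True
    then obtain c where "p = [:c:]" by (rule degree_eq_zeroE)
    then show ?thesis using assms by (intro exI[of _ "[:c / b:]"]) simp
  next
    case False
    have "degree (- smult (1 / b) (pderiv p)) < degree p"
      using False assms by (simp add: degree_pderiv)
    then obtain s where s: "pderiv s + smult b s = - smult (1 / b) (pderiv p)"
      using less by blast
    have "pderiv (smult (1 / b) p + s) + smult b (smult (1 / b) p + s)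
        = smult (1 / b) (pderiv p) + p + (pderiv s + smult b s)"
      using assms by (simp add: pderiv_add pderiv_smult smult_add_right algebra_simps)
    also have "\<dots> = p" unfolding s by simp
    finally show ?thesis by blast
  qed
qed

lemma quasi_poly_fps_antiderivative:
  assumes "quasi_poly_fps G"
  shows "\<exists>F. quasi_poly_fps F \<and> fps_deriv F = G"
  using assms
proof induction
  case zero
  show ?case by (intro exI[of _ 0]) (simp add: quasi_poly_fps.zero)
next
  case (add F p a)
  then obtain F' where F': "quasi_poly_fps F'" "fps_deriv F' = F" by blast
  \<comment> \<open>The operator r' + a r is plain differentiation when \<open>a = 0\<close>; both
    cases are surjective on polynomials.\<close>
  have "\<exists>r. pderiv r + smult a r = p"
    using poly_antiderivative poly_exp_antiderivative by (cases "a = 0") auto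
  then obtain r where r: "pderiv r + smult a r = p" by blast
  have "fps_deriv (fps_of_poly r * fps_exp a) = fps_of_poly p * fps_exp a"
    by (simp add: r[symmetric] fps_of_poly_pderiv fps_of_poly_add fps_of_poly_smult algebra_simps)
  then show ?case
    using F' quasi_poly_fps.add[OF F'(1), of r a] by (intro exI[of _ "fps_of_poly r * fps_exp a + F'"]) simp
qed

text \<open>Integrating factor: the derivative of e^(-at) F is e^(-at) (F' - a F), so e^(-at) F is a
  quasi-polynomial up to a constant.\<close>

lemma quasi_poly_fps_ode:
  fixes F :: "complex fps"
  assumes "quasi_poly_fps (fps_deriv F - fps_const a * F)"
  shows "quasi_poly_fps F"
proof -
  have e: "fps_exp a * fps_exp (- a) = (1 :: complex fps)"
    using fps_exp_add_mult[of a "- a"] by simp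
  obtain G where G: "quasi_poly_fps G"
      "fps_deriv G = fps_exp (- a) * (fps_deriv F - fps_const a * F)"
    using quasi_poly_fps_antiderivative[OF quasi_poly_fps_mult_exp[OF assms]] by blast
  have "fps_const (- a) = - fps_const a" by simp
  then have "fps_deriv (fps_exp (- a) * F) = fps_deriv G"
    unfolding G(2) by (simp only: fps_deriv_mult fps_exp_deriv) (simp add: algebra_simps del: fps_const_neg)
  then obtain c where "fps_exp (- a) * F = fps_const c + G"
    using fps_deriv_eq_iff_ex by blast
  then have "F = fps_exp a * (fps_const c + G)"
    using e by (metis mult.assoc mult_1)
  then show ?thesis
    using quasi_poly_fps_mult_exp quasi_poly_fps_add quasi_poly_fps_const G(1) by simp
qed

lemma quasi_poly_fps_imp_expansion:
  assumes "quasi_poly_fps F"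
  shows "\<exists>R. quasi_polynomial R \<and> R has_fps_expansion F"
  using assms
proof induction
  case zero
  show ?case
    unfolding quasi_polynomial_def by (intro exI[of _ "\<lambda>_. 0"] conjI exI[of _ "[]"]) auto
next
  case (add F p a)
  then obtain R ps where R: "R has_fps_expansion F"
      and ps: "\<And>t. R t = (\<Sum>(p, a)\<leftarrow>ps. poly p t * exp (a * t))"
    unfolding quasi_polynomial_def by blast
  have "poly p has_fps_expansion fps_of_poly p"
    by (simp add: has_fps_expansion_def)
  then have "(\<lambda>t. poly p t * exp (a * t) + R t) has_fps_expansion fps_of_poly p * fps_exp a + F"
    by (intro has_fps_expansion_add has_fps_expansion_mult has_fps_expansion_exp R)
  moreover have "quasi_polynomial (\<lambda>t. poly p t * exp (a * t) + R t)"
    unfolding quasi_polynomial_def by (intro exI[of _ "(p, a) # ps"]) (simp add: ps)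
  ultimately show ?case by blast
qed

section \<open>Exponential generating functions of functionals on polynomials\<close>

definition moment_fps :: "(complex poly \<Rightarrow> complex) \<Rightarrow> complex fps" where
  "moment_fps D = Abs_fps (\<lambda>k. D (monom 1 k) / fact k)"

text \<open>Multiplying the argument of the functional by \<open>[:-a, 1:]\<close> applies \<open>d/dt - a\<close> to its
  exponential generating function, so splitting off the roots of \<open>q\<close> reduces to \<open>q\<close> constant.\<close>

lemma quasi_poly_fps_moment_fps:
  fixes D :: "complex poly \<Rightarrow> complex"
  assumes "\<And>p p'. D (p + p') = D p + D p'" and "\<And>c p. D (smult c p) = c * D p"
    and "q \<noteq> 0" and "\<And>g. D (q * g) = 0"
  shows "quasi_poly_fps (moment_fps D)"
  using assms
proof (induction "degree q" arbitrary: q D)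
  case 0
  then obtain c where c: "q = [:c:]" by (metis degree_eq_zeroE)
  have "D g = 0" for g
    using "0.prems"(4)[of "smult (1 / c) g"] "0.prems"(3) c by simp
  then have "moment_fps D = 0" by (simp add: moment_fps_def fps_eq_iff)
  then show ?case by (simp add: quasi_poly_fps.zero)
next
  case (Suc n)
  note D_add = Suc.prems(1) and D_smult = Suc.prems(2)
  obtain a where "poly q a = 0"
    using fundamental_theorem_of_algebra[of q] Suc.hyps(2) constant_degree[of q] by auto
  then obtain r where r: "q = [:-a, 1:] * r" using poly_eq_0_iff_dvd by blast
  with Suc.prems(3) have "r \<noteq> 0" by auto
  have "degree q = degree [:-a, 1:] + degree r"
    unfolding r using \<open>r \<noteq> 0\<close> by (intro degree_mult_eq) auto
  with Suc.hyps(2) have "n = degree r" by simp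
  define D' where "D' g = D ([:-a, 1:] * g)" for g
  have "quasi_poly_fps (moment_fps D')"
  proof (rule Suc.hyps(1))
    show "n = degree r" by fact
    show "r \<noteq> 0" by fact
    show "D' (r * g) = 0" for g
      using Suc.prems(4)[of g] by (simp only: D'_def r mult.assoc)
    show "D' (p + p') = D' p + D' p'" for p p'
      by (simp only: D'_def D_add distrib_left)
    show "D' (smult c p) = c * D' p" for c p
      by (simp only: D'_def D_smult mult_smult_right)
  qed
  also have "D' (monom 1 k) = D (monom 1 (Suc k)) - a * D (monom 1 k)" for k
  proof -
    have "[:-a, 1:] * monom 1 k = monom 1 (Suc k) + smult (- a) (monom 1 k)"
      by (simp add: monom_Suc)
    then show ?thesis by (simp only: D'_def D_add D_smult) simp
  qed
  then have "moment_fps D' = fps_deriv (moment_fps D) - fps_const a * moment_fps D"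
    by (simp add: fps_eq_iff moment_fps_def diff_divide_distrib del: of_nat_Suc)
  finally show ?case by (rule quasi_poly_fps_ode)
qed

text \<open>Formally \<open>moment_fps D\<close> is \<open>D\<close> applied to e^(xt), and
  replacing x by x + c multiplies e^(xt) by e^(ct). On coefficients this is the binomial
  theorem.\<close>

lemma moment_fps_shift:
  assumes add: "\<And>p p'. D (p + p') = D p + D p'" and smult: "\<And>c p. D (smult c p) = c * D p"
  shows "moment_fps (\<lambda>p. D (p \<circ>\<^sub>p [:c, 1:])) = moment_fps D * fps_exp c"
proof (rule fps_ext)
  fix k
  have D_0: "D 0 = 0" using smult[of 0 0] by simp
  have D_sum: "D (\<Sum>i\<in>A. f i) = (\<Sum>i\<in>A. D (f i))" for A and f :: "nat \<Rightarrow> _"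
    by (induction A rule: infinite_finite_induct) (simp_all add: D_0 add)
  have "monom 1 k \<circ>\<^sub>p [:c, 1:] = [:c, 1:] ^ k"
    by (induction k) (simp_all add: monom_Suc pcompose_pCons one_pCons)
  also have "[:c, 1:] ^ k = (monom 1 1 + [:c:]) ^ k"
    by (simp add: monom_Suc one_pCons)
  also have "(monom 1 1 + [:c:]) ^ k = (\<Sum>i\<le>k. of_nat (k choose i) * monom 1 1 ^ i * [:c:] ^ (k - i))"
    by (rule binomial_ring)
  also have "\<dots> = (\<Sum>i\<le>k. smult (of_nat (k choose i) * c ^ (k - i)) (monom 1 i))"
    by (intro sum.cong) (simp_all add: monom_power poly_const_pow of_nat_poly mult.commute)
  finally have "D (monom 1 k \<circ>\<^sub>p [:c, 1:]) / fact k
      = (\<Sum>i\<le>k. of_nat (k choose i) * c ^ (k - i) * D (monom 1 i) / fact k)"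
    by (simp add: D_sum smult sum_divide_distrib)
  also have "\<dots> = (\<Sum>i\<le>k. D (monom 1 i) / fact i * (c ^ (k - i) / fact (k - i)))"
    by (intro sum.cong) (simp_all add: binomial_fact)
  finally show "fps_nth (moment_fps (\<lambda>p. D (p \<circ>\<^sub>p [:c, 1:]))) k = fps_nth (moment_fps D * fps_exp c) k"
    by (simp add: moment_fps_def fps_mult_nth atLeast0AtMost)
qed

text \<open>The difference of \<open>L\<close> and its shift vanishes on multiples of
  \<open>q\<close>, so its moment series is a quasi-polynomial. By the shift rule that series is
  \<open>moment_fps L\<close> times 1 - e^(-2t), and dividing expansions at 0 gives the quotient of
  functions.\<close>

proposition moment_series_eq_quasi_polynomial_quotient:
  fixes L :: "complex poly \<Rightarrow> complex"
  assumes add: "\<And>p p'. L (p + p') = L p + L p'" and smult: "\<And>c p. L (smult c p) = c * L p"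
    and q: "q \<noteq> 0" and L_q: "\<And>g. L (q * g) = L ((q * g) \<circ>\<^sub>p [:-2, 1:])"
  shows "\<exists>R. quasi_polynomial R \<and> R 0 = 0 \<and>
           (\<exists>\<epsilon>>0. \<forall>t::complex. 0 < norm t \<and> norm t < \<epsilon> \<longrightarrow>
              (\<lambda>k. L (monom 1 k) / fact k * t ^ k) sums (R t / (1 - exp (- 2 * t))))"
proof -
  define E where "E = 1 - fps_exp (- 2 :: complex)"
  define D where "D p = L p - L (p \<circ>\<^sub>p [:-2, 1:])" for p
  have "quasi_poly_fps (moment_fps D)"
    by (rule quasi_poly_fps_moment_fps[of _ q])
      (simp_all add: D_def add smult q L_q[symmetric] pcompose_add pcompose_smult right_diff_distrib)
  then obtain R where R: "quasi_polynomial R" "R has_fps_expansion moment_fps D"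
    using quasi_poly_fps_imp_expansion by blast
  have "moment_fps D = moment_fps L - moment_fps (\<lambda>p. L (p \<circ>\<^sub>p [:-2, 1:]))"
    by (simp add: moment_fps_def D_def fps_eq_iff diff_divide_distrib)
  also have "\<dots> = moment_fps L * E"
    by (subst moment_fps_shift[OF add smult]) (simp_all add: E_def algebra_simps)
  finally have DE: "moment_fps D = moment_fps L * E" .
  \<comment> \<open>\<open>E\<close> has a simple zero at 0: \<open>E0\<close> forces
    \<open>R 0 = 0\<close>, while \<open>E1\<close> makes \<open>E\<close> nonzero and so permits
    division.\<close>
  have E0: "fps_nth E 0 = 0" and E1: "fps_nth E 1 = 2" by (simp_all add: E_def)
  have "E \<noteq> 0" using E1 by auto
  have R0: "R 0 = 0"
    using R(2) DE E0
    by (auto simp: has_fps_expansion_def eval_fps_at_0 dest: eventually_nhds_x_imp_x)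
  have sub: "moment_fps D / E = moment_fps L" using DE \<open>E \<noteq> 0\<close> by simp
  \<comment> \<open>The zero series has \<open>subdegree\<close> 0, less than that of
    \<open>E\<close>, so the comparison of subdegrees needed for the division requires
    \<open>moment_fps L\<close> to be nonzero.\<close>
  show ?thesis
  proof (cases "moment_fps L = 0")
    case True
    then have "(\<lambda>k. L (monom 1 k) / fact k * t ^ k) sums 0" for t
      by (simp add: moment_fps_def fps_eq_iff)
    then show ?thesis
      by (intro exI[of _ "\<lambda>_. 0"] conjI exI[of _ "1::real"])
        (auto simp: quasi_polynomial_def intro: exI[of _ "[]"])
  next
    case False
    have "(\<lambda>t. 1 - exp (- 2 * t)) has_fps_expansion E"
      unfolding E_def by (intro has_fps_expansion_diff has_fps_expansion_1 has_fps_expansion_exp)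
    moreover have "subdegree E \<le> subdegree (moment_fps D)"
      using False \<open>E \<noteq> 0\<close> by (simp add: DE)
    \<comment> \<open>\<open>c\<close> fills the removable singularity at 0.\<close>
    ultimately obtain c where
      "(\<lambda>t. if t = 0 then c else R t / (1 - exp (- 2 * t))) has_fps_expansion moment_fps D / E"
      using has_fps_expansion_divide[OF R(2)] \<open>E \<noteq> 0\<close> by blast
    then have rad: "fps_conv_radius (moment_fps L) > 0" and
      ev: "eventually (\<lambda>t. eval_fps (moment_fps L) t
             = (if t = 0 then c else R t / (1 - exp (- 2 * t)))) (nhds 0)"
      unfolding sub has_fps_expansion_def by auto
    \<comment> \<open>Within the disc of convergence \<open>eval_fps\<close> is the value of a
      genuinely convergent series, as \<open>sums\<close> demands.\<close>
    have "eventually (\<lambda>t. t \<in> eball 0 (fps_conv_radius (moment_fps L))) (nhds 0)"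
      using rad by (intro eventually_nhds_in_open) (auto simp: zero_ereal_def)
    with ev have "eventually (\<lambda>t. t \<noteq> 0 \<longrightarrow>
        (\<lambda>k. fps_nth (moment_fps L) k * t ^ k) sums (R t / (1 - exp (- 2 * t)))) (nhds 0)"
    proof eventually_elim
      case (elim t)
      then show ?case using sums_eval_fps[of t "moment_fps L"] by (auto simp: dist_norm)
    qed
    then obtain \<epsilon> where "\<epsilon> > 0" "\<forall>t. dist t 0 < \<epsilon> \<longrightarrow> t \<noteq> 0 \<longrightarrow>
        (\<lambda>k. fps_nth (moment_fps L) k * t ^ k) sums (R t / (1 - exp (- 2 * t)))"
      unfolding eventually_nhds_metric by blast
    then show ?thesis using R R0 by (auto simp: moment_fps_def)
  qed
qed

subsection \<open>The free algebra as a ring\<close>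

text \<open>Only the cut at \<open>length u\<close> can contribute; a word shorter than
  \<open>u\<close> fails the test on its prefix, and then both sides are 0.\<close>

lemma fmul_fmon:
  "fmul (fmon u) b w = (if take (length u) w = u then b (drop (length u) w) else 0)"
proof -
  have "fmon u (take i w) * b (drop i w)
      = (if i = length u then if take (length u) w = u then b (drop (length u) w) else 0 else 0)"
    if "i \<le> length w" for i
    using that by (auto simp: fmon_def)
  then have "fmul (fmon u) b w
      = (\<Sum>i\<le>length w. if i = length u then if take (length u) w = u then b (drop (length u) w) else 0 else 0)"
    by (simp add: fmul_def)
  then show ?thesis by (auto simp: not_le)
qed

lemma fmul_fmon_right_Nil: "fmul a (fmon []) = a"
proof
  fix w
  have "a (take i w) * fmon [] (drop i w) = (if i = length w then a w else 0)"
    if "i \<le> length w" for i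
    using that by (auto simp: fmon_def)
  then show "fmul a (fmon []) w = a w" by (simp add: fmul_def)
qed

lemma fmul_assoc: "fmul (fmul a b) c = fmul a (fmul b c)"
proof
  fix w :: "gen list"
  \<comment> \<open>The indices are the lengths of the three pieces of \<open>w\<close>; this shape
    lets the reindexing of triple Cauchy products apply.\<close>
  define f where "f i j k = a (take i w) * b (take j (drop i w)) * c (drop (i + j) w)" for i j k :: nat
  have "fmul (fmul a b) c w = (\<Sum>j=0..length w. \<Sum>i=0..j. f i (j - i) (length w - j))"
    by (auto simp: fmul_def f_def sum_distrib_right min_def drop_take atLeast0AtMost intro!: sum.cong)
  also have "\<dots> = (\<Sum>j=0..length w. \<Sum>i=0..length w - j. f j i (length w - j - i))"
    by (rule fps_mult_assoc_lemma)
  also have "\<dots> = fmul a (fmul b c) w"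
    by (auto simp: fmul_def f_def sum_distrib_left atLeast0AtMost add.commute mult.assoc intro!: sum.cong)
  finally show "fmul (fmul a b) c w = fmul a (fmul b c) w" .
qed

lemma FreeAlg_fmon: "fmon u \<in> FreeAlg"
  by (auto simp: FreeAlg_def fmon_def)

lemma FreeAlg_fzero: "fzero \<in> FreeAlg"
  by (auto simp: FreeAlg_def fzero_def)

lemma FreeAlg_fsc: "a \<in> FreeAlg \<Longrightarrow> fsc c a \<in> FreeAlg"
  by (auto simp: FreeAlg_def fsc_def)

lemma FreeAlg_fadd: "a \<in> FreeAlg \<Longrightarrow> b \<in> FreeAlg \<Longrightarrow> fadd a b \<in> FreeAlg"
  by (auto simp: FreeAlg_def fadd_def intro: finite_subset[of _ "{w. a w \<noteq> 0} \<union> {w. b w \<noteq> 0}"])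

lemma FreeAlg_fsub: "a \<in> FreeAlg \<Longrightarrow> b \<in> FreeAlg \<Longrightarrow> fsub a b \<in> FreeAlg"
  by (auto simp: FreeAlg_def fsub_def intro: finite_subset[of _ "{w. a w \<noteq> 0} \<union> {w. b w \<noteq> 0}"])

lemma FreeAlg_fmul:
  assumes "a \<in> FreeAlg" "b \<in> FreeAlg"
  shows "fmul a b \<in> FreeAlg"
proof -
  have "{w. fmul a b w \<noteq> 0} \<subseteq> (\<lambda>(u, v). u @ v) ` ({w. a w \<noteq> 0} \<times> {w. b w \<noteq> 0})"
  proof safe
    fix w assume "fmul a b w \<noteq> 0"
    then obtain i where "a (take i w) * b (drop i w) \<noteq> 0"
      unfolding fmul_def by (meson sum.not_neutral_contains_not_neutral)
    then show "w \<in> (\<lambda>(u, v). u @ v) ` ({w. a w \<noteq> 0} \<times> {w. b w \<noteq> 0})"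
      by (intro image_eqI[of _ _ "(take i w, drop i w)"]) auto
  qed
  then show ?thesis using assms by (auto simp: FreeAlg_def intro: finite_subset)
qed

text \<open>As a type, the free algebra can be an instance of \<open>ring_1\<close>, so ring
  simplification applies and finiteness of support is carried by the type.\<close>

typedef falg = FreeAlg
  by (rule exI, rule FreeAlg_fzero)

setup_lifting type_definition_falg

instantiation falg :: ring_1
begin

lift_definition zero_falg :: falg is fzero by (rule FreeAlg_fzero)
lift_definition one_falg :: falg is "fmon []" by (rule FreeAlg_fmon)
lift_definition plus_falg :: "falg \<Rightarrow> falg \<Rightarrow> falg" is fadd by (rule FreeAlg_fadd)
lift_definition minus_falg :: "falg \<Rightarrow> falg \<Rightarrow> falg" is fsub by (rule FreeAlg_fsub)
lift_definition uminus_falg :: "falg \<Rightarrow> falg" is "fsc (-1)" by (rule FreeAlg_fsc)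
lift_definition times_falg :: "falg \<Rightarrow> falg \<Rightarrow> falg" is fmul by (rule FreeAlg_fmul)

instance
proof
  show "(0::falg) \<noteq> 1" by transfer (auto simp: fzero_def fmon_def fun_eq_iff)
  show "1 * a = a" for a :: falg by transfer (auto simp: fmul_fmon)
  show "a * 1 = a" for a :: falg by transfer (rule fmul_fmon_right_Nil)
  show "a * b * c = a * (b * c)" for a b c :: falg by transfer (rule fmul_assoc)
qed (transfer; simp add: fadd_def fsub_def fsc_def fzero_def fmul_def fun_eq_iff algebra_simps sum.distrib)+

end

section \<open>Scalars and polynomials in \<open>H\<close>\<close>

lift_definition cst :: "complex \<Rightarrow> falg" is "\<lambda>c. fsc c (fmon [])"
  by (intro FreeAlg_fsc FreeAlg_fmon)

lift_definition word :: "gen list \<Rightarrow> falg" is fmon by (rule FreeAlg_fmon)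

abbreviation "xx \<equiv> word [GX]"
abbreviation "yy \<equiv> word [GY]"
abbreviation "hh \<equiv> word [GH]"

lemma fsc_eq_fmul: "fsc c a = fmul (fsc c (fmon [])) a"
proof -
  have "fmul (fsc c (fmon [])) a w = c * fmul (fmon []) a w" for w
    by (simp add: fmul_def fsc_def sum_distrib_left mult.assoc)
  then show ?thesis by (simp add: fmul_fmon fsc_def fun_eq_iff)
qed

lemma Rep_cst_mult: "Rep_falg (cst c * a) = fsc c (Rep_falg a)"
  by transfer (simp add: fsc_eq_fmul[symmetric])

lemma cst_commute: "a * cst c = cst c * a"
proof transfer
  fix a c
  have "fmul a (fsc c (fmon [])) w = c * fmul a (fmon []) w" for w
    by (simp add: fmul_def fsc_def sum_distrib_left mult_ac)
  then show "fmul a (fsc c (fmon [])) = fmul (fsc c (fmon [])) a"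
    unfolding fsc_eq_fmul[of c a, symmetric] by (simp add: fmul_fmon_right_Nil fsc_def fun_eq_iff)
qed

lemma cst_left_commute: "a * (cst c * b) = cst c * (a * b)"
  by (metis cst_commute mult.assoc)

lemma cst_add: "cst (c + d) = cst c + cst d"
  by transfer (simp add: fsc_def fadd_def algebra_simps)

lemma cst_mult: "cst (c * d) = cst c * cst d"
  by transfer (simp only: fsc_eq_fmul[symmetric], simp add: fsc_def mult.assoc)

lemma cst_0 [simp]: "cst 0 = 0" and cst_1 [simp]: "cst 1 = 1"
  by (transfer; simp add: fsc_def fzero_def)+

lemma cst_minus: "cst (- c) = - cst c"
  by transfer (simp add: fsc_def)

text \<open>The element \<open>p(H)\<close>.\<close>

lift_definition hpoly :: "complex poly \<Rightarrow> falg"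
  is "\<lambda>p w. if set w \<subseteq> {GH} then coeff p (length w) else 0"
proof -
  fix p :: "complex poly"
  have "{w. (if set w \<subseteq> {GH} then coeff p (length w) else 0) \<noteq> 0}
      \<subseteq> {w. set w \<subseteq> {GH} \<and> length w \<le> degree p}"
    by (auto simp: le_degree split: if_splits)
  then show "(\<lambda>w. if set w \<subseteq> {GH} then coeff p (length w) else 0) \<in> FreeAlg"
    unfolding FreeAlg_def using finite_lists_length_le[of "{GH}" "degree p"]
    by (simp add: finite_subset)
qed

lemma hpoly_0 [simp]: "hpoly 0 = 0"
  by (simp add: Rep_falg_inject[symmetric] hpoly.rep_eq zero_falg.rep_eq fzero_def fun_eq_iff)

lemma hpoly_add: "hpoly (p + q) = hpoly p + hpoly q"
  by (simp add: Rep_falg_inject[symmetric] hpoly.rep_eq plus_falg.rep_eq fadd_def fun_eq_iff)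

lemma hpoly_diff: "hpoly (p - q) = hpoly p - hpoly q"
  by (simp add: Rep_falg_inject[symmetric] hpoly.rep_eq minus_falg.rep_eq fsub_def fun_eq_iff)

text \<open>Splitting a word at its first letter gives this Horner recursion, which drives the later
  inductions on polynomials.\<close>

lemma hpoly_pCons: "hpoly (pCons a p) = cst a + hh * hpoly p"
proof -
  have "Rep_falg (hpoly (pCons a p)) w = Rep_falg (cst a + hh * hpoly p) w" for w
    by (cases w) (auto simp: hpoly.rep_eq plus_falg.rep_eq times_falg.rep_eq word.rep_eq cst.rep_eq
        fadd_def fsc_def fmul_fmon fmon_def[of "[]"])
  then show ?thesis by (simp add: Rep_falg_inject[symmetric] fun_eq_iff)
qed

lemma Rep_hpoly_monom: "Rep_falg (hpoly (monom 1 k)) = fmon (replicate k GH)"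
proof -
  have "w = replicate k GH \<longleftrightarrow> set w \<subseteq> {GH} \<and> length w = k" for w
    by (auto intro!: replicate_eqI)
  then have "Rep_falg (hpoly (monom 1 k)) w = fmon (replicate k GH) w" for w
    by (simp add: hpoly.rep_eq fmon_def)
  then show ?thesis by (rule ext)
qed

lemma hpoly_smult: "hpoly (smult c p) = cst c * hpoly p"
  by (induction p) (simp_all add: hpoly_pCons cst_mult cst_left_commute distrib_left)

lemma hpoly_mult: "hpoly (p * q) = hpoly p * hpoly q"
  by (induction p) (simp_all add: hpoly_pCons hpoly_add hpoly_smult algebra_simps)

lemma hpoly_const: "hpoly [:c:] = cst c"
  by (simp add: hpoly_pCons)

lemma hpoly_X_plus: "hpoly [:c, 1:] = cst c + hh"
  by (simp add: hpoly_pCons)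

lemma hpoly_commute: "hpoly p * hpoly q = hpoly q * hpoly p"
  by (metis hpoly_mult mult.commute)

subsection \<open>Relations modulo the ideal\<close>

text \<open>Equality in the quotient algebra, expressed on representatives because the ideal varies
  with the parameter \<open>lam\<close>.\<close>

definition cong_gl :: "complex \<Rightarrow> falg \<Rightarrow> falg \<Rightarrow> bool" where
  "cong_gl lam a b \<longleftrightarrow> Rep_falg (a - b) \<in> rel_ideal lam"

lemma cong_gl_refl: "cong_gl lam a a"
  using ideal_gen.zero by (simp add: cong_gl_def zero_falg.rep_eq rel_ideal_def)

lemma cong_gl_trans [trans]:
  assumes "cong_gl lam a b" "cong_gl lam b c"
  shows "cong_gl lam a c"
proof -
  have "Rep_falg ((a - b) + (b - c)) \<in> rel_ideal lam"
    using assms unfolding cong_gl_def rel_ideal_def plus_falg.rep_eq by (rule ideal_gen.add)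
  then show ?thesis by (simp add: cong_gl_def)
qed

lemma cong_gl_eq_trans [trans]: "cong_gl lam a b \<Longrightarrow> b = c \<Longrightarrow> cong_gl lam a c"
  "a = b \<Longrightarrow> cong_gl lam b c \<Longrightarrow> cong_gl lam a c"
  by simp_all

lemma cong_gl_add:
  assumes "cong_gl lam a b" "cong_gl lam c d"
  shows "cong_gl lam (a + c) (b + d)"
proof -
  have "Rep_falg ((a - b) + (c - d)) \<in> rel_ideal lam"
    using assms unfolding cong_gl_def rel_ideal_def plus_falg.rep_eq by (rule ideal_gen.add)
  then show ?thesis by (simp add: cong_gl_def algebra_simps)
qed

lemma cong_gl_mult_left:
  assumes "cong_gl lam a b"
  shows "cong_gl lam (c * a) (c * b)"
proof -
  have "Rep_falg (c * (a - b)) \<in> rel_ideal lam"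
    using assms Rep_falg unfolding cong_gl_def rel_ideal_def times_falg.rep_eq
    by (rule ideal_gen.lmult)
  then show ?thesis by (simp add: cong_gl_def algebra_simps)
qed

lemma cong_gl_mult_right:
  assumes "cong_gl lam a b"
  shows "cong_gl lam (a * c) (b * c)"
proof -
  have "Rep_falg ((a - b) * c) \<in> rel_ideal lam"
    using assms Rep_falg unfolding cong_gl_def rel_ideal_def times_falg.rep_eq
    by (rule ideal_gen.rmult)
  then show ?thesis by (simp add: cong_gl_def algebra_simps)
qed

lemma cong_gl_diff:
  assumes "cong_gl lam a b" "cong_gl lam c d"
  shows "cong_gl lam (a - c) (b - d)"
  using cong_gl_add[OF assms(1) cong_gl_mult_left[OF assms(2), of "-1"]] by simp

lemma cong_gl_relI: "r \<in> rels lam \<Longrightarrow> Rep_falg (a - b) = r \<Longrightarrow> cong_gl lam a b"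
  by (simp add: cong_gl_def rel_ideal_def ideal_gen.gen)

lemmas falg_lin_rep_eq = plus_falg.rep_eq minus_falg.rep_eq Rep_cst_mult
lemmas falg_mult_rep_eq = times_falg.rep_eq one_falg.rep_eq word.rep_eq

lemma cong_gl_XY_comm: "cong_gl lam (xx * yy - yy * xx) hh"
  by (rule cong_gl_relI[of "fsub (fbr fX fY) fH"])
    (simp_all add: rels_def falg_lin_rep_eq falg_mult_rep_eq fbr_def)

text \<open>The relation [H,Y] = -2Y in the form HY = Y(H - 2): moving \<open>H\<close> to the right
  past \<open>Y\<close> costs a shift.\<close>

lemma cong_gl_HY: "cong_gl lam (hh * yy) (yy * hpoly [:-2, 1:])"
proof (rule cong_gl_relI[of "fadd (fbr fH fY) (fsc 2 fY)"])
  have "hh * yy - yy * hpoly [:-2, 1:] = (hh * yy - yy * hh) + cst 2 * yy"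
    by (simp add: hpoly_X_plus cst_minus algebra_simps cst_commute)
  then show "Rep_falg (hh * yy - yy * hpoly [:-2, 1:]) = fadd (fbr fH fY) (fsc 2 fY)"
    by (simp only: falg_lin_rep_eq) (simp only: falg_mult_rep_eq fbr_def)
qed (simp add: rels_def)

lemma cong_gl_HX: "cong_gl lam (hh * xx) (xx * hpoly [:2, 1:])"
proof (rule cong_gl_relI[of "fsub (fbr fH fX) (fsc 2 fX)"])
  have "hh * xx - xx * hpoly [:2, 1:] = (hh * xx - xx * hh) - cst 2 * xx"
    by (simp add: hpoly_X_plus algebra_simps cst_commute)
  then show "Rep_falg (hh * xx - xx * hpoly [:2, 1:]) = fsub (fbr fH fX) (fsc 2 fX)"
    by (simp only: falg_lin_rep_eq) (simp only: falg_mult_rep_eq fbr_def)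
qed (simp add: rels_def)

text \<open>This is \<open>(lam\<^sup>2 - (H - 1)\<^sup>2)/4\<close>, expanded.\<close>

definition casimir_poly :: "complex \<Rightarrow> complex poly" where
  "casimir_poly lam = [:(lam\<^sup>2 - 1) / 4, 1 / 2, - 1 / 4:]"

lemma cong_gl_XY: "cong_gl lam (xx * yy) (hpoly (casimir_poly lam))"
proof (rule cong_gl_relI)
  let ?r = "fadd (fsub (fmul fX fY) (fsc (lam\<^sup>2 / 4) fone))
            (fadd (fsc (1/4) (fmul fH fH)) (fsub (fsc (1/4) fone) (fsc (1/2) fH)))"
  show "?r \<in> rels lam" by (simp add: rels_def)
  have c: "cst ((lam\<^sup>2 - 1) / 4) = cst (lam\<^sup>2 / 4) - cst (1 / 4)"
    using cst_add[of "lam\<^sup>2 / 4" "- (1 / 4)"] by (simp add: cst_minus diff_divide_distrib)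
  have "xx * yy - hpoly (casimir_poly lam)
      = (xx * yy - cst (lam\<^sup>2 / 4) * 1) + (cst (1/4) * (hh * hh) + (cst (1/4) * 1 - cst (1/2) * hh))"
    by (simp add: casimir_poly_def hpoly_pCons cst_minus c algebra_simps cst_commute cst_left_commute)
  then show "Rep_falg (xx * yy - hpoly (casimir_poly lam)) = ?r"
    by (simp only: falg_lin_rep_eq) (simp only: falg_mult_rep_eq)
qed

text \<open>YX = XY - H, and completing the square gives P(H) - H = P(H + 2).\<close>

lemma cong_gl_YX: "cong_gl lam (yy * xx) (hpoly (casimir_poly lam \<circ>\<^sub>p [:2, 1:]))"
proof -
  have "yy * xx = xx * yy - (xx * yy - yy * xx)" by simp
  also have "cong_gl lam \<dots> (hpoly (casimir_poly lam) - hh)"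
    by (intro cong_gl_diff cong_gl_XY cong_gl_XY_comm)
  also have "hh = hpoly [:0, 1:]" by (simp add: hpoly_X_plus)
  also have "hpoly (casimir_poly lam) - hpoly [:0, 1:] = hpoly (casimir_poly lam \<circ>\<^sub>p [:2, 1:])"
    unfolding hpoly_diff[symmetric]
    by (rule arg_cong[of _ _ hpoly]) (simp add: casimir_poly_def pcompose_pCons field_simps)
  finally show ?thesis .
qed

text \<open>Moving one \<open>H\<close> past \<open>a\<close> shifts it by \<open>c\<close>;
  Horner's scheme extends this to every polynomial in \<open>H\<close>.\<close>

lemma cong_gl_hpoly_mult:
  assumes "cong_gl lam (hh * a) (a * hpoly [:c, 1:])"
  shows "cong_gl lam (hpoly p * a) (a * hpoly (p \<circ>\<^sub>p [:c, 1:]))"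
proof (induction p)
  case 0
  show ?case by (simp add: cong_gl_refl)
next
  case (pCons b p)
  have "hpoly (pCons b p) * a = cst b * a + hh * (hpoly p * a)"
    by (simp add: hpoly_pCons algebra_simps)
  also have "cong_gl lam \<dots> (cst b * a + hh * (a * hpoly (p \<circ>\<^sub>p [:c, 1:])))"
    by (intro cong_gl_add cong_gl_refl cong_gl_mult_left pCons.IH)
  also have "\<dots> = cst b * a + (hh * a) * hpoly (p \<circ>\<^sub>p [:c, 1:])"
    by (simp add: mult.assoc)
  also have "cong_gl lam \<dots> (cst b * a + (a * hpoly [:c, 1:]) * hpoly (p \<circ>\<^sub>p [:c, 1:]))"
    by (intro cong_gl_add cong_gl_refl cong_gl_mult_right assms)
  also have "\<dots> = a * hpoly (pCons b p \<circ>\<^sub>p [:c, 1:])"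
    by (simp only: pcompose_pCons hpoly_add hpoly_mult hpoly_const distrib_left mult.assoc cst_commute)
  finally show ?case .
qed

text \<open>With \<open>XY = P(H)\<close> and \<open>YX = P(H + 2)\<close> the bracket is \<open>w(H) - w(H + 2)\<close>
  for \<open>w(H) = P(H) f(H) g(H - 2)\<close>.\<close>

lemma cong_gl_bracket:
  fixes lam :: complex and f g :: "complex poly"
  defines "q \<equiv> (casimir_poly lam * f) \<circ>\<^sub>p [:2, 1:]"
  shows "cong_gl lam ((xx * hpoly g) * (yy * hpoly f) - (yy * hpoly f) * (xx * hpoly g))
           (hpoly ((q * g) \<circ>\<^sub>p [:-2, 1:] - q * g))"
proof -
  let ?P = "casimir_poly lam"
  \<comment> \<open>The two shifts cancel, so q(H - 2) = P(H) f(H).\<close>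
  have inv: "[:2, 1:] \<circ>\<^sub>p [:-2, 1:] = [:0, 1 :: complex:]" by (simp add: pcompose_pCons)
  have "(xx * hpoly g) * (yy * hpoly f) = xx * (hpoly g * yy) * hpoly f"
    by (simp add: mult.assoc)
  also have "cong_gl lam \<dots> (xx * (yy * hpoly (g \<circ>\<^sub>p [:-2, 1:])) * hpoly f)"
    by (intro cong_gl_mult_right cong_gl_mult_left cong_gl_hpoly_mult cong_gl_HY)
  also have "\<dots> = (xx * yy) * (hpoly (g \<circ>\<^sub>p [:-2, 1:]) * hpoly f)"
    by (simp add: mult.assoc)
  also have "cong_gl lam \<dots> (hpoly ?P * (hpoly (g \<circ>\<^sub>p [:-2, 1:]) * hpoly f))"
    by (intro cong_gl_mult_right cong_gl_XY)
  also have "\<dots> = hpoly ((q * g) \<circ>\<^sub>p [:-2, 1:])"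
    by (simp add: hpoly_mult[symmetric] q_def pcompose_mult pcompose_assoc[symmetric] inv mult_ac)
  finally have 1: "cong_gl lam ((xx * hpoly g) * (yy * hpoly f)) (hpoly ((q * g) \<circ>\<^sub>p [:-2, 1:]))" .
  have "(yy * hpoly f) * (xx * hpoly g) = yy * (hpoly f * xx) * hpoly g"
    by (simp add: mult.assoc)
  also have "cong_gl lam \<dots> (yy * (xx * hpoly (f \<circ>\<^sub>p [:2, 1:])) * hpoly g)"
    by (intro cong_gl_mult_right cong_gl_mult_left cong_gl_hpoly_mult cong_gl_HX)
  also have "\<dots> = (yy * xx) * (hpoly (f \<circ>\<^sub>p [:2, 1:]) * hpoly g)"
    by (simp add: mult.assoc)
  also have "cong_gl lam \<dots> (hpoly (?P \<circ>\<^sub>p [:2, 1:]) * (hpoly (f \<circ>\<^sub>p [:2, 1:]) * hpoly g))"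
    by (intro cong_gl_mult_right cong_gl_YX)
  also have "\<dots> = hpoly (q * g)"
    by (simp add: hpoly_mult q_def pcompose_mult mult.assoc)
  finally have 2: "cong_gl lam ((yy * hpoly f) * (xx * hpoly g)) (hpoly (q * g))" .
  show ?thesis using cong_gl_diff[OF 1 2] by (simp add: hpoly_diff)
qed

text \<open>The assumption says that \<open>a\<close> has degree \<open>i\<close>; since p(H)
  commutes with \<open>H\<close>, right multiplication by it preserves the degree.\<close>

lemma gl_gradeI:
  assumes "cong_gl lam (hh * a) (a * hpoly [:2 * of_int i, 1:])"
  shows "Rep_falg (a * hpoly p) \<in> gl_grade lam i"
proof -
  have "hh * (a * hpoly p) = hh * a * hpoly p" by (simp add: mult.assoc)
  also have "cong_gl lam \<dots> (a * hpoly [:2 * of_int i, 1:] * hpoly p)"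
    by (intro cong_gl_mult_right assms)
  also have "\<dots> = a * hpoly p * hh + cst (2 * of_int i) * (a * hpoly p)"
    using hpoly_commute[of p "[:0, 1:]"]
    by (simp add: hpoly_X_plus algebra_simps cst_commute cst_left_commute)
  finally have "Rep_falg ((hh * (a * hpoly p) - a * hpoly p * hh) - cst (2 * of_int i) * (a * hpoly p))
      \<in> rel_ideal lam"
    by (simp add: cong_gl_def diff_diff_eq)
  then show ?thesis
    unfolding gl_grade_def fbr_def falg_lin_rep_eq
    using Rep_falg[of "a * hpoly p"] by (simp add: times_falg.rep_eq word.rep_eq)
qed

lemma hpoly_gl_grade: "Rep_falg (hpoly p) \<in> gl_grade lam 0"
  using gl_gradeI[of lam 1 0 p] by (simp add: hpoly_X_plus cong_gl_refl)

lemma X_hpoly_gl_grade: "Rep_falg (xx * hpoly p) \<in> gl_grade lam 1"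
  using gl_gradeI[of lam xx 1 p] by (simp add: cong_gl_HX)

lemma Y_hpoly_gl_grade: "Rep_falg (yy * hpoly p) \<in> gl_grade lam (-1)"
  using gl_gradeI[of lam yy "-1" p] by (simp add: cong_gl_HY)

subsection \<open>Highest weight vectors\<close>

text \<open>A linear map from the infinite-dimensional space of polynomials into a
  finite-dimensional space cannot be injective.\<close>

lemma finite_dim_poly_kernel:
  fixes sc :: "complex \<Rightarrow> 'v::ab_group_add \<Rightarrow> 'v" and T :: "complex poly \<Rightarrow> 'v"
  assumes "vector_space sc" and T_add: "\<And>p q. T (p + q) = T p + T q"
    and T_smult: "\<And>c p. T (smult c p) = sc c (T p)"
    and B: "finite B" "\<And>p. T p \<in> module.span sc B"
  shows "\<exists>f. f \<noteq> 0 \<and> T f = 0"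
proof (rule ccontr)
  interpret vector_space sc by fact
  assume "\<not> ?thesis"
  then have ker: "f = 0" if "T f = 0" for f using that by blast
  have T_0: "T 0 = 0" using T_smult[of 0 0] by simp
  have T_sum: "T (\<Sum>i\<in>A. p i) = (\<Sum>i\<in>A. T (p i))" for A and p :: "nat \<Rightarrow> _"
    by (induction A rule: infinite_finite_induct) (simp_all add: T_0 T_add)
  define e where "e k = T (monom 1 k)" for k
  have inj: "inj e"
  proof
    fix k l assume "e k = e l"
    then have "T (monom 1 k + smult (-1) (monom 1 l)) = 0"
      by (simp only: T_add T_smult e_def) simp
    then have "monom 1 k = monom (1::complex) l" using ker by fastforce
    then show "k = l" by (simp add: monom_eq_iff')
  qed
  \<comment> \<open>The range \<open>{..card B}\<close> has \<open>card B + 1\<close> elements, one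
    more than the spanning set allows.\<close>
  have "independent (e ` {..card B})"
  proof (subst dependent_finite, simp, safe)
    fix c k
    assume "(\<Sum>v\<in>e ` {..card B}. sc (c v) v) = 0" and k: "k \<le> card B" "c (e k) \<noteq> 0"
    then have "(\<Sum>i\<le>card B. sc (c (e i)) (e i)) = 0"
      by (subst (asm) sum.reindex[OF inj_on_subset[OF inj]]) auto
    then have "T (\<Sum>i\<le>card B. smult (c (e i)) (monom 1 i)) = 0"
      by (simp only: T_sum T_smult e_def)
    then have "coeff (\<Sum>i\<le>card B. smult (c (e i)) (monom 1 i)) k = 0"
      by (subst ker) simp_all
    then show False using k by (simp add: smult_monom coeff_sum)
  qed
  then have "card (e ` {..card B}) \<le> card B"
    using independent_span_bound[of B] B by (auto simp: e_def)
  then show False using card_image[OF inj_on_subset[OF inj], of "{..card B}"] by simp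
qed

section \<open>Graded pieces of a quasi-finite module\<close>

lemma quasi_finite_graded:
  assumes "quasi_finite lam sc \<rho> Vg" and "a \<in> gl_grade lam i"
  shows "\<rho> a ` Vg j \<subseteq> Vg (i + j)"
proof -
  have "\<forall>i j. \<forall>a\<in>gl_grade lam i. \<rho> a ` Vg j \<subseteq> Vg (i + j)"
    using assms(1) unfolding quasi_finite_def by (elim conjE)
  then show ?thesis using assms(2) by simp
qed

lemma quasi_finite_spanned:
  assumes "quasi_finite lam sc \<rho> Vg"
  obtains B where "finite B" "Vg j \<subseteq> module.span sc B"
proof -
  have "\<forall>j. \<exists>B. finite B \<and> B \<subseteq> Vg j \<and> Vg j \<subseteq> module.span sc B"
    using assms unfolding quasi_finite_def by (elim conjE)
  then have "\<exists>B. finite B \<and> B \<subseteq> Vg j \<and> Vg j \<subseteq> module.span sc B" by (rule spec)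
  then show ?thesis by (elim exE conjE) (rule that)
qed

lemma quasi_finite_decomposition:
  assumes "quasi_finite lam sc \<rho> Vg"
  shows "\<exists>!f. finite {j. f j \<noteq> 0} \<and> (\<forall>j. f j \<in> Vg j) \<and> x = (\<Sum>j\<in>{j. f j \<noteq> 0}. f j)"
proof -
  have "\<forall>x. \<exists>!f. finite {j. f j \<noteq> 0} \<and> (\<forall>j. f j \<in> Vg j) \<and> x = (\<Sum>j\<in>{j. f j \<noteq> 0}. f j)"
    using assms unfolding quasi_finite_def by (elim conjE)
  then show ?thesis by (rule spec)
qed

text \<open>Uniqueness of the decomposition of 0. The offset \<open>i\<close> fits the images of
  homogeneous components under an element of degree \<open>i\<close>.\<close>

lemma quasi_finite_homogeneous_sum_eq_0:
  assumes qf: "quasi_finite lam sc \<rho> Vg" and "vector_space sc"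
    and S: "finite S" "\<And>j. j \<in> S \<Longrightarrow> g j \<in> Vg (i + j)" "(\<Sum>j\<in>S. g j) = 0" and "j \<in> S"
  shows "g j = 0"
proof -
  interpret vector_space sc by fact
  have sub: "subspace (Vg k)" for k using qf by (simp add: quasi_finite_def)
  let ?dec = "\<lambda>f. finite {k. f k \<noteq> 0} \<and> (\<forall>k. f k \<in> Vg k) \<and> 0 = (\<Sum>k\<in>{k. f k \<noteq> 0}. f k)"
  have "\<exists>\<^sub>\<le>\<^sub>1f. ?dec f"
    using quasi_finite_decomposition[OF qf, of 0] unfolding ex1_iff_ex_Uniq by (rule conjunct2)
  note uniq = Uniq_D[OF this]
  \<comment> \<open>The family reindexed by true degree and extended by 0, to be compared with the
    zero decomposition.\<close>
  define f where "f k = (if k - i \<in> S then g (k - i) else 0)" for k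
  have supp: "{k. f k \<noteq> 0} \<subseteq> (+) i ` S"
  proof
    fix k assume "k \<in> {k. f k \<noteq> 0}"
    then have "k - i \<in> S" by (simp add: f_def split: if_splits)
    then show "k \<in> (+) i ` S" by (rule rev_image_eqI) simp
  qed
  have "f k \<in> Vg k" for k
    using S(2)[of "k - i"] subspace_0[OF sub[of k]] by (simp add: f_def)
  moreover have "(\<Sum>k\<in>{k. f k \<noteq> 0}. f k) = (\<Sum>k\<in>(+) i ` S. f k)"
    using supp S(1) by (intro sum.mono_neutral_left) auto
  then have "0 = (\<Sum>k\<in>{k. f k \<noteq> 0}. f k)"
    using S(3) by (simp add: sum.reindex f_def)
  moreover have "finite {k. f k \<noteq> 0}" using supp S(1) by (auto intro: finite_subset)
  ultimately have "?dec f" by blast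
  moreover have "?dec (\<lambda>_. 0)" using subspace_0[OF sub] by simp
  ultimately have "f = (\<lambda>_. 0)" by (rule uniq)
  then have "f (i + j) = 0" by simp
  then show ?thesis using \<open>j \<in> S\<close> by (simp add: f_def)
qed

text \<open>The highest weight vector is not assumed homogeneous, but each of its homogeneous
  components is again a weight vector annihilated by the positive part.\<close>

lemma homogeneous_highest_weight_vector:
  fixes sc :: "complex \<Rightarrow> 'v::ab_group_add \<Rightarrow> 'v"
  assumes rep: "gl_rep lam sc \<rho>" and qf: "quasi_finite lam sc \<rho> Vg"
    and hw: "highest_weight lam sc \<rho> v \<theta>"
  obtains u j where "u \<in> Vg j" "u \<noteq> 0" "\<And>i a. i > 0 \<Longrightarrow> a \<in> gl_grade lam i \<Longrightarrow> \<rho> a u = 0"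
    "\<And>h. h \<in> gl_grade lam 0 \<Longrightarrow> \<rho> h u = sc (\<theta> h) u"
proof -
  have vs: "vector_space sc" using rep by (simp add: gl_rep_def)
  interpret vector_space sc by fact
  have sub: "subspace (Vg k)" for k using qf by (simp add: quasi_finite_def)
  obtain f where f: "finite {j. f j \<noteq> 0}" "\<And>j. f j \<in> Vg j" "v = (\<Sum>j\<in>{j. f j \<noteq> 0}. f j)"
    using ex1_implies_ex[OF quasi_finite_decomposition[OF qf, of v]]
    by (elim exE conjE) (rule that, assumption, erule spec, assumption)
  have "v \<noteq> 0" using hw by (simp add: highest_weight_def)
  then obtain j where j: "f j \<noteq> 0" using f(3) by force
  have img: "\<rho> a x \<in> Vg (i + k)" if "a \<in> gl_grade lam i" "x \<in> Vg k" for a i k x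
    using quasi_finite_graded[OF qf that(1)] that(2) by blast
  have sum: "\<rho> a v = (\<Sum>k\<in>{j. f j \<noteq> 0}. \<rho> a (f k))" if "a \<in> gl_grade lam i" for a i
  proof -
    have "a \<in> FreeAlg" using that by (simp add: gl_grade_def)
    then have "Vector_Spaces.linear sc sc (\<rho> a)" using rep by (simp add: gl_rep_def)
    then interpret l: Vector_Spaces.linear sc sc "\<rho> a" .
    show ?thesis by (subst f(3)) (rule l.sum)
  qed
  show ?thesis
  proof
    show "f j \<in> Vg j" by (rule f)
    show "f j \<noteq> 0" by fact
    \<comment> \<open>The images of the components lie in the distinct degrees \<open>i + k\<close>
      and sum to \<open>\<rho> a v = 0\<close>, so each of them vanishes.\<close>
    show "\<rho> a (f j) = 0" if "i > 0" "a \<in> gl_grade lam i" for i a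
    proof (rule quasi_finite_homogeneous_sum_eq_0[OF qf vs f(1)])
      show "\<rho> a (f k) \<in> Vg (i + k)" for k using img that f(2) by blast
      show "(\<Sum>k\<in>{j. f j \<noteq> 0}. \<rho> a (f k)) = 0"
        using hw that sum[OF that(2)] by (simp add: highest_weight_def)
    qed (use j in simp)
    show "\<rho> h (f j) = sc (\<theta> h) (f j)" if h: "h \<in> gl_grade lam 0" for h
    proof -
      \<comment> \<open>The same argument in degree 0, applied to the components of
        \<open>\<rho> h v - sc (\<theta> h) v = 0\<close>.\<close>
      have "\<rho> h (f j) - sc (\<theta> h) (f j) = 0"
      proof (rule quasi_finite_homogeneous_sum_eq_0[OF qf vs f(1)])
        show "\<rho> h (f k) - sc (\<theta> h) (f k) \<in> Vg (0 + k)" for k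
          using img[OF h f(2)] f(2) sub by (intro subspace_diff subspace_scale) auto
        have "\<rho> h v = sc (\<theta> h) v" using hw h by (simp add: highest_weight_def)
        then have "(\<Sum>k\<in>{j. f j \<noteq> 0}. \<rho> h (f k)) = (\<Sum>k\<in>{j. f j \<noteq> 0}. sc (\<theta> h) (f k))"
          unfolding sum[OF h] by (simp add: f(3) scale_sum_right)
        then show "(\<Sum>k\<in>{j. f j \<noteq> 0}. \<rho> h (f k) - sc (\<theta> h) (f k)) = 0"
          by (simp add: sum_subtractf)
      qed (use j in simp)
      then show ?thesis by simp
    qed
  qed
qed

theorem theorem3p3:
  fixes lam :: complex
    and sc :: "complex \<Rightarrow> 'v::ab_group_add \<Rightarrow> 'v"
    and \<rho> :: "ncpoly \<Rightarrow> 'v \<Rightarrow> 'v"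
    and Vg :: "int \<Rightarrow> 'v set"
    and v :: 'v
    and \<theta> :: "ncpoly \<Rightarrow> complex"
  assumes "gl_rep lam sc \<rho>"
    and "quasi_finite lam sc \<rho> Vg"
    and "highest_weight lam sc \<rho> v \<theta>"
  shows "\<exists>R. quasi_polynomial R \<and> R 0 = 0 \<and>
           (\<exists>\<epsilon>>0. \<forall>t::complex. 0 < norm t \<and> norm t < \<epsilon> \<longrightarrow>
              (\<lambda>k. \<theta> (fmon (replicate k GH)) / fact k * t ^ k) sums (R t / (1 - exp (- 2 * t))))"
proof -
  note rep = assms(1) and qf = assms(2)
  interpret vector_space sc using rep by (simp add: gl_rep_def)
  obtain u j where u: "u \<in> Vg j" "u \<noteq> 0"
    and pos: "\<And>i a. i > 0 \<Longrightarrow> a \<in> gl_grade lam i \<Longrightarrow> \<rho> a u = 0"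
    and wt: "\<And>h. h \<in> gl_grade lam 0 \<Longrightarrow> \<rho> h u = sc (\<theta> h) u"
    using homogeneous_highest_weight_vector[OF assms] by blast
  define A where "A a = \<rho> (Rep_falg a)" for a
  have A_add: "A (a + b) x = A a x + A b x" for a b x
    using rep Rep_falg by (simp add: A_def gl_rep_def plus_falg.rep_eq)
  have A_cst: "A (cst c * a) x = sc c (A a x)" for c a x
    using rep Rep_falg by (simp add: A_def gl_rep_def Rep_cst_mult)
  have A_cong: "A a x = A b x" if "cong_gl lam a b" for a b x
  proof -
    have "A (a - b) x = 0"
      using rep that unfolding A_def gl_rep_def cong_gl_def by blast
    then show ?thesis using A_add[of "a - b" b x] by simp
  qed
  \<comment> \<open>\<open>\<rho>\<close> represents the Lie algebra, so a product need not act as a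
    composition; only commutators can be evaluated this way.\<close>
  have A_bracket: "A (a * b - b * a) x = A a (A b x) - A b (A a x)" for a b x
  proof -
    have "Rep_falg (a * b - b * a) = fbr (Rep_falg a) (Rep_falg b)"
      by (simp only: minus_falg.rep_eq times_falg.rep_eq fbr_def)
    then show ?thesis using rep Rep_falg by (simp add: A_def gl_rep_def)
  qed
  have A_0: "A a 0 = 0" for a
  proof -
    have "Vector_Spaces.linear sc sc (A a)" using rep Rep_falg by (simp add: A_def gl_rep_def)
    then interpret l: Vector_Spaces.linear sc sc "A a" .
    show ?thesis by (rule l.zero)
  qed
  define L where "L p = \<theta> (Rep_falg (hpoly p))" for p
  have A_hpoly: "A (hpoly p) u = sc (L p) u" for p
    unfolding A_def L_def by (rule wt) (rule hpoly_gl_grade)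
  \<comment> \<open>\<open>highest_weight\<close> does not state that \<open>\<theta>\<close> is
    linear. As \<open>u\<close> is nonzero, the scalar by which p(H) acts on it is unique, so
    \<open>L\<close> inherits linearity from the action.\<close>
  have L_eqI: "L p = c" if "A (hpoly p) u = sc c u" for p c
    using that u(2) by (simp add: A_hpoly)
  have L_add: "L (p + q) = L p + L q" for p q
    by (rule L_eqI) (simp add: hpoly_add A_add A_hpoly scale_left_distrib)
  have L_smult: "L (smult c p) = c * L p" for c p
    by (rule L_eqI) (simp add: hpoly_smult A_cst A_hpoly)

  \<comment> \<open>All vectors (Y p(H)) u lie in this one piece, of degree
    \<open>-1 + j\<close>.\<close>
  obtain B where B: "finite B" "Vg (-1 + j) \<subseteq> span B"
    by (rule quasi_finite_spanned[OF qf])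
  have "A (yy * hpoly p) u \<in> span B" for p
  proof -
    have "\<rho> (Rep_falg (yy * hpoly p)) ` Vg j \<subseteq> Vg (-1 + j)"
      by (rule quasi_finite_graded[OF qf Y_hpoly_gl_grade])
    then show ?thesis using u(1) B(2) by (auto simp: A_def)
  qed
  then have "\<exists>f. f \<noteq> 0 \<and> A (yy * hpoly f) u = 0"
    by (intro finite_dim_poly_kernel[OF vector_space_axioms _ _ B(1)])
      (simp_all only: hpoly_add hpoly_smult distrib_left cst_left_commute A_add A_cst)
  then obtain f where f: "f \<noteq> 0" "A (yy * hpoly f) u = 0" by blast
  define q where "q = (casimir_poly lam * f) \<circ>\<^sub>p [:2, 1:]"
  \<comment> \<open>The leading coefficient is -1/4 for every \<open>lam\<close>, and substituting H
    + 2 cannot annihilate a nonzero polynomial.\<close>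
  have "casimir_poly lam \<noteq> 0" by (simp add: casimir_poly_def)
  then have "q \<noteq> 0" using f(1) by (simp add: q_def pcompose_eq_0_iff)
  have L_q: "L (q * g) = L ((q * g) \<circ>\<^sub>p [:-2, 1:])" for g
  proof -
    \<comment> \<open>\<open>X g(H)\<close> has positive degree and kills \<open>u\<close>, as does
      \<open>Y f(H)\<close> by the choice of \<open>f\<close>. Hence their bracket, a polynomial in
      \<open>H\<close>, also kills \<open>u\<close>.\<close>
    have "A (xx * hpoly g) u = 0"
      unfolding A_def by (rule pos[of 1]) (simp_all add: X_hpoly_gl_grade)
    then have "A (hpoly ((q * g) \<circ>\<^sub>p [:-2, 1:] - q * g)) u = 0"
      using A_cong[OF cong_gl_bracket[of lam g f], of u]
      by (simp add: A_bracket f(2) A_0 q_def)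
    then have "L ((q * g) \<circ>\<^sub>p [:-2, 1:] - q * g) = 0"
      by (intro L_eqI) simp
    then show ?thesis
      using L_add[of "(q * g) \<circ>\<^sub>p [:-2, 1:] - q * g" "q * g"] by simp
  qed
  show ?thesis
    using moment_series_eq_quasi_polynomial_quotient[of L, OF L_add L_smult \<open>q \<noteq> 0\<close> L_q]
    by (simp only: L_def Rep_hpoly_monom)
qed

end
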